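(* Let $G$ be a finite simple graph on $n\ge 2$ vertices and let $H$ be a connected graph with at least two vertices. Then (i) $\lambda(G,H)=0$ if and only if $G$ is disconnected; (ii) $\lambda(G,H)\le \frac{n}{n-1}$, and equality $\lambda(G,H)=\frac{n}{n-1}$ holds if and only if $G=K_n$.
   Context: All graphs are finite and simple. For a graph $G$, $d_v$ denotes the degree of a vertex $v$, $u\sim v$ means $u,v$ are adjacent, and $\mathrm{vol}(G)=\sum_{v\in V(G)} d_v$. For a metric space $(X,d)$ and a map $f:V(G)\to X$ set $$R_f(G,X)=\frac{\mathrm{vol}(G)\sum_{u\sim v} d(f(u),f(v))^2}{\sum_{u,v} d(f(u),f(v))^2 d_u d_v},$$ where the numerator sum runs over the edges $\{u,v\}$ of $G$ and the denominator sum over unordered pairs $\{u,v\}$ of vertices of $G$; define $\lambda(G,X)=\inf_f R_f(G,X)$, the infimum over all $f:V(G)\to X$ for which the denominator is nonzero. A connected graph $H$ is regarded as the metric space $(V(H),d_H)$, where $d_H$ is the shortest-path distance, and $\lambda(G,H)$ denotes $\lambda(G,(V(H),d_H))$. $K_n$ is the complete graph on $n$ vertices.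
   Formalization: The graph G is additionally assumed to have no isolated vertices; without this the claim is false, e.g. for G the disjoint union of K_2 and K_1, which is disconnected but has λ(G,H) = 2 > 3/2. *)

theory Defs
  imports "HOL-Analysis.Abstract_Metric_Spaces" "Graph_Theory.Graph_Theory"
begin

text \<open>
  Finite simple graphs are rendered by the locale \<^locale>\<open>graph\<close>: an edge
  $\{u,v\}$ is the pair of opposite arcs $(u,v)$ and $(v,u)$, so that the degree of a vertex is
  its out-degree.  The topological predicate of the same name being in scope as well, graph
  connectivity is always written \<open>Digraph_Component.connected\<close>.
\<close>

definition vol :: "('a, 'b) pre_digraph \<Rightarrow> nat" where
  "vol G = (\<Sum>v\<in>verts G. out_degree G v)"

text \<open>
  A sum over edges or over unordered pairs of vertices is half of the sum over arcs or over
  ordered pairs (a pair $(v,v)$ contributes $0$ below, as $d(f(v),f(v)) = 0$); see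
  \<open>edge_energy_eq_sum_edges\<close> and \<open>pair_energy_eq_sum_pairs\<close>.
\<close>

definition edge_energy :: "('a, 'b) pre_digraph \<Rightarrow> ('x \<Rightarrow> 'x \<Rightarrow> real) \<Rightarrow> ('a \<Rightarrow> 'x) \<Rightarrow> real" where
  "edge_energy G d f = (\<Sum>e\<in>arcs G. (d (f (tail G e)) (f (head G e)))\<^sup>2) / 2"

definition pair_energy :: "('a, 'b) pre_digraph \<Rightarrow> ('x \<Rightarrow> 'x \<Rightarrow> real) \<Rightarrow> ('a \<Rightarrow> 'x) \<Rightarrow> real" where
  "pair_energy G d f =
     (\<Sum>u\<in>verts G. \<Sum>v\<in>verts G.
        (d (f u) (f v))\<^sup>2 * real (out_degree G u) * real (out_degree G v)) / 2"

definition rayleigh :: "('a, 'b) pre_digraph \<Rightarrow> ('x \<Rightarrow> 'x \<Rightarrow> real) \<Rightarrow> ('a \<Rightarrow> 'x) \<Rightarrow> real" where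
  "rayleigh G d f = real (vol G) * edge_energy G d f / pair_energy G d f"

text \<open>
  The infimum is taken in the reals.  The set is bounded below by $0$, and it is nonempty as soon
  as \<open>G\<close> has an edge and \<open>M\<close> has two points; otherwise the value has no meaning.
\<close>

definition lambda_metric ::
    "('a, 'b) pre_digraph \<Rightarrow> 'x set \<Rightarrow> ('x \<Rightarrow> 'x \<Rightarrow> real) \<Rightarrow> real" where
  "lambda_metric G M d =
     Inf {rayleigh G d f | f. f \<in> verts G \<rightarrow> M \<and> pair_energy G d f \<noteq> 0}"

definition graph_dist :: "('c, 'e) pre_digraph \<Rightarrow> 'c \<Rightarrow> 'c \<Rightarrow> real" where
  "graph_dist H u v = real_of_ereal (wf_digraph.\<mu> H (\<lambda>_. 1) u v)"

definition lambda_graph :: "('a, 'b) pre_digraph \<Rightarrow> ('c, 'e) pre_digraph \<Rightarrow> real" where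
  "lambda_graph G H = lambda_metric G (verts H) (graph_dist H)"


section \<open>Consistency of the encoding\<close>

lemma half_sum_sym:
  fixes F :: "'a set \<Rightarrow> real"
  assumes "finite A" "sym A" "irrefl A"
  shows "(\<Sum>p\<in>A. F {fst p, snd p}) / 2 = (\<Sum>s\<in>{{u, v} | u v. (u, v) \<in> A}. F s)"
proof -
  let ?g = "\<lambda>p. {fst p, snd p}"
  have img: "{{u, v} | u v. (u, v) \<in> A} = ?g ` A"
    by force
  have fib: "(\<Sum>p\<in>{p \<in> A. ?g p = s}. F (?g p)) = 2 * F s" if "s \<in> ?g ` A" for s
  proof -
    from that obtain u v where uv: "(u, v) \<in> A" "s = {u, v}" by force
    have "u \<noteq> v" using uv(1) assms(3) by (auto simp: irrefl_def)
    moreover have "(v, u) \<in> A" using uv(1) assms(2) by (auto dest: symD)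
    ultimately have "{p \<in> A. ?g p = s} = {(u, v), (v, u)}"
      using uv by (auto simp: doubleton_eq_iff)
    then show ?thesis using \<open>u \<noteq> v\<close> uv(2) by (simp add: insert_commute)
  qed
  have "(\<Sum>p\<in>A. F (?g p)) = (\<Sum>s\<in>?g ` A. \<Sum>p\<in>{p \<in> A. ?g p = s}. F (?g p))"
    using assms(1) by (rule sum.image_gen)
  also have "\<dots> = (\<Sum>s\<in>?g ` A. 2 * F s)" using fib by (intro sum.cong) auto
  finally show ?thesis by (simp add: img sum_distrib_left[symmetric])
qed

lemma edge_energy_eq_sum_edges:
  assumes "graph G"
    and F: "\<And>u v. F {u, v} = (d (f u) (f v))\<^sup>2"
  shows "edge_energy G d f = (\<Sum>s\<in>{{u, v} | u v. u \<rightarrow>\<^bsub>G\<^esub> v}. F s)"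
proof -
  interpret graph G by fact
  have inj: "inj_on (arc_to_ends G) (arcs G)"
    using no_multi_arcs by (auto simp: inj_on_def)
  have fin: "finite (arcs_ends G)" by (simp add: arcs_ends_def)
  have sy: "sym (arcs_ends G)" using sym_arcs by (simp add: symmetric_def)
  have ir: "irrefl (arcs_ends G)"
    using no_loops by (auto simp: irrefl_def arcs_ends_def arc_to_ends_def)
  have "edge_energy G d f = (\<Sum>p\<in>arcs_ends G. F {fst p, snd p}) / 2"
    unfolding edge_energy_def arcs_ends_def sum.reindex[OF inj]
    by (simp add: F arc_to_ends_def)
  also have "\<dots> = (\<Sum>s\<in>{{u, v} | u v. u \<rightarrow>\<^bsub>G\<^esub> v}. F s)"
    using half_sum_sym[OF fin sy ir] .
  finally show ?thesis .
qed

lemma pair_energy_eq_sum_pairs: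
  assumes "finite (verts G)"
    and d0: "\<And>v. v \<in> verts G \<Longrightarrow> d (f v) (f v) = 0"
    and F: "\<And>u v. F {u, v} = (d (f u) (f v))\<^sup>2 * real (out_degree G u) * real (out_degree G v)"
  shows "pair_energy G d f =
    (\<Sum>s\<in>{{u, v} | u v. u \<in> verts G \<and> v \<in> verts G \<and> u \<noteq> v}. F s)"
proof -
  let ?A = "{p \<in> verts G \<times> verts G. fst p \<noteq> snd p}"
  have "(\<Sum>p\<in>verts G \<times> verts G. F {fst p, snd p}) = (\<Sum>p\<in>?A. F {fst p, snd p})"
  proof (rule sum.mono_neutral_right)
    show "\<forall>p\<in>verts G \<times> verts G - ?A. F {fst p, snd p} = 0"
      using d0 by (auto simp: F[of x x for x, simplified])
  qed (use assms(1) in auto)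
  then have "pair_energy G d f = (\<Sum>p\<in>?A. F {fst p, snd p}) / 2"
    unfolding pair_energy_def by (simp add: sum.cartesian_product F split_beta)
  also have "\<dots> = (\<Sum>s\<in>{{u, v} | u v. (u, v) \<in> ?A}. F s)"
    by (rule half_sum_sym) (use assms(1) in \<open>auto simp: sym_def irrefl_def\<close>)
  finally show ?thesis by (simp add: conj_assoc)
qed

lemma graph_dist_attained:
  assumes "graph H" "Digraph_Component.connected H" "u \<in> verts H" "v \<in> verts H"
  shows "\<exists>p. pre_digraph.awalk H u p v \<and> graph_dist H u v = real (length p)
    \<and> (\<forall>q. pre_digraph.awalk H u q v \<longrightarrow> length p \<le> length q)"
proof -
  interpret graph H by fact
  have "u \<rightarrow>\<^sup>*\<^bsub>H\<^esub> v"
    using assms(2-4) by (simp add: connected_def strongly_connected_def reachable_mk_symmetric_eq[OF sym_arcs])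
  then have ex: "\<exists>p. awalk u p v" by (simp add: reachable_awalk)
  define p where "p = (ARG_MIN length p. awalk u p v)"
  have p: "awalk u p v" "\<And>q. awalk u q v \<Longrightarrow> length p \<le> length q"
    using ex arg_min_nat_lemma[of "\<lambda>p. awalk u p v" _ length] unfolding p_def by auto
  have cost: "awalk_cost (\<lambda>_. 1) q = real (length q)" for q
    by (induction q) auto
  have "\<mu> (\<lambda>_. 1) u v = ereal (real (length p))"
    unfolding \<mu>_def cost by (rule antisym) (use p in \<open>auto intro: INF_lower2 INF_greatest\<close>)
  then show ?thesis using p by (auto simp: graph_dist_def)
qed

lemma (in graph) awalk_reverse:
  assumes "awalk u p v"
  shows "\<exists>q. awalk v q u \<and> length q = length p"
  using assms
proof (induction p arbitrary: u)
  case Nil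
  then show ?case by (intro exI[of _ "[]"]) (auto simp: awalk_Nil_iff)
next
  case (Cons e p)
  then have e: "e \<in> arcs G" "u = tail G e" "awalk (head G e) p v"
    by (auto simp: awalk_Cons_iff)
  then obtain q where q: "awalk v q (head G e)" "length q = length p"
    using Cons.IH by blast
  have "(head G e, tail G e) \<in> arcs_ends G"
    using e(1) sym_arcs by (auto simp: symmetric_def arcs_ends_def arc_to_ends_def dest!: symD)
  then obtain e' where "e' \<in> arcs G" "tail G e' = head G e" "head G e' = tail G e"
    by (auto simp: arcs_ends_def arc_to_ends_def)
  then have "awalk (head G e) [e'] u"
    using e by (simp add: awalk_Cons_iff awalk_Nil_iff)
  with q show ?case
    by (intro exI[of _ "q @ [e']"]) (auto intro: awalk_appendI)
qed

lemma Metric_space_graph_dist: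
  assumes "graph H" "Digraph_Component.connected H"
  shows "Metric_space (verts H) (graph_dist H)"
proof -
  interpret graph H by fact
  have cost: "awalk_cost (\<lambda>_. 1) q = real (length q)" for q
    by (induction q) auto
  have le: "\<mu> (\<lambda>_. 1) u v \<le> \<mu> (\<lambda>_. 1) v u" for u v
    unfolding \<mu>_def cost
    by (rule INF_mono) (use awalk_reverse in fastforce)
  have attained: "\<exists>p. awalk u p v \<and> graph_dist H u v = real (length p)
      \<and> (\<forall>q. awalk u q v \<longrightarrow> length p \<le> length q)" if "u \<in> verts H" "v \<in> verts H" for u v
    using graph_dist_attained[OF assms that] .
  show ?thesis
  proof
    fix x y
    show "0 \<le> graph_dist H x y"
      unfolding graph_dist_def \<mu>_def cost
      by (intro real_of_ereal_pos INF_greatest) auto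
    show "graph_dist H x y = graph_dist H y x"
      unfolding graph_dist_def using le[of x y] le[of y x] by simp
  next
    fix x y assume xy: "x \<in> verts H" "y \<in> verts H"
    obtain p where p: "awalk x p y" "graph_dist H x y = real (length p)"
      "\<And>q. awalk x q y \<Longrightarrow> length p \<le> length q"
      using attained[OF xy] by blast
    show "graph_dist H x y = 0 \<longleftrightarrow> x = y"
    proof
      assume "graph_dist H x y = 0"
      with p show "x = y" by (auto simp: awalk_Nil_iff)
    next
      assume "x = y"
      then show "graph_dist H x y = 0"
        using p(2) p(3)[of "[]"] xy by (simp add: awalk_Nil_iff)
    qed
  next
    fix x y z assume xyz: "x \<in> verts H" "y \<in> verts H" "z \<in> verts H"
    obtain p where p: "awalk x p y" "graph_dist H x y = real (length p)"
      using attained xyz by blast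
    obtain q where q: "awalk y q z" "graph_dist H y z = real (length q)"
      using attained xyz by blast
    obtain r where r: "graph_dist H x z = real (length r)" "awalk x r z"
      "\<And>q. awalk x q z \<Longrightarrow> length r \<le> length q"
      using attained[OF xyz(1,3)] by blast
    have "length r \<le> length (p @ q)" using p q by (intro r(3)) (rule awalk_appendI)
    then show "graph_dist H x z \<le> graph_dist H x y + graph_dist H y z"
      using p q r by simp
  qed
qed

end

theory Submission
  imports Defs
begin

text \<open>
  A map onto two points of \<open>H\<close> is a cut of \<open>G\<close>.  A union of connected components is a cut of
  energy $0$, and isolating a vertex $v$ yields the quotient
  $\mathrm{vol}(G) / (\mathrm{vol}(G) - d_v)$, which is at most $n/(n-1)$ for $v$ of minimal
  degree, with equality only if \<open>G\<close> is regular.  If \<open>G\<close> is $k$-regular with $k < n-1$, isolating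
  the two ends of an edge yields $n(k-1)/(k(n-2)) < n/(n-1)$, whereas on $K_n$ every quotient is
  $n/(n-1)$.  Since \<open>H\<close> is finite, the infimum
  is attained, and a map of energy $0$ on a connected \<open>G\<close> is constant.
\<close>

section \<open>Cuts\<close>

lemma (in fin_digraph) card_arcs_tail_in:
  assumes "S \<subseteq> verts G"
  shows "card {e \<in> arcs G. tail G e \<in> S} = (\<Sum>v\<in>S. out_degree G v)"
proof -
  have "{e \<in> arcs G. tail G e \<in> S} = (\<Union>v\<in>S. out_arcs G v)"
    by auto
  also have "card \<dots> = (\<Sum>v\<in>S. card (out_arcs G v))"
    using finite_subset[OF assms] by (intro card_UN_disjoint) auto
  finally show ?thesis
    by (simp add: out_degree_def)
qed

text \<open>Without parallel arcs an arc is determined by its ends, so a count of arcs becomes a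
  count of pairs, which can be swapped or enumerated explicitly.\<close>

lemma (in nomulti_digraph) card_arcs_arcs_ends:
  "card {e \<in> arcs G. P (tail G e) (head G e)} = card {(u, v). u \<rightarrow>\<^bsub>G\<^esub> v \<and> P u v}"
proof -
  have "{(u, v). u \<rightarrow>\<^bsub>G\<^esub> v \<and> P u v} = arc_to_ends G ` {e \<in> arcs G. P (tail G e) (head G e)}"
    by (auto simp: arcs_ends_def arc_to_ends_def)
  then show ?thesis
    by (simp add: card_image inj_on_def no_multi_arcs)
qed

lemma (in graph) card_arcs_flip:
  "card {e \<in> arcs G. P (head G e) (tail G e)} = card {e \<in> arcs G. P (tail G e) (head G e)}"
proof -
  have "{(u, v). u \<rightarrow>\<^bsub>G\<^esub> v \<and> P v u} = prod.swap ` {(u, v). u \<rightarrow>\<^bsub>G\<^esub> v \<and> P u v}"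
    by (auto simp: image_iff intro: graph_symmetric)
  then show ?thesis
    unfolding card_arcs_arcs_ends[of P] card_arcs_arcs_ends[of "\<lambda>x y. P y x"]
    by (simp add: card_image)
qed

text \<open>The bracket is the number of edges leaving \<open>S\<close>: arcs with tail in
  \<open>S\<close> minus arcs staying inside. Both terms are easy to evaluate for the cuts used
  below.\<close>

lemma (in graph) edge_energy_cut:
  assumes "S \<subseteq> verts G" and d: "d a a = 0" "d b b = 0" "d b a = d a b"
  shows "edge_energy G d (\<lambda>v. if v \<in> S then a else b) =
    (d a b)\<^sup>2 * (real (\<Sum>v\<in>S. out_degree G v)
      - real (card {e \<in> arcs G. tail G e \<in> S \<and> head G e \<in> S}))"
proof -
  let ?t = "\<lambda>e. of_bool (tail G e \<in> S) :: real" and ?h = "\<lambda>e. of_bool (head G e \<in> S) :: real"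
  have c: "(\<Sum>e\<in>arcs G. of_bool (P e)) = real (card {e \<in> arcs G. P e})" for P
    by (simp add: sum_of_bool_eq Int_def)
  \<comment> \<open>For 0/1 values t and h, the expression t + h - 2th is 1 exactly when t and h
    differ, that is, when the arc crosses the cut.\<close>
  have "edge_energy G d (\<lambda>v. if v \<in> S then a else b) =
      (\<Sum>e\<in>arcs G. (d a b)\<^sup>2 * (?t e + ?h e
        - 2 * of_bool (tail G e \<in> S \<and> head G e \<in> S))) / 2"
    unfolding edge_energy_def by (intro arg_cong2[of _ _ _ _ "(/)"] sum.cong) (auto simp: d)
  also have "\<dots> = (d a b)\<^sup>2 * (real (card {e \<in> arcs G. tail G e \<in> S})
      + real (card {e \<in> arcs G. head G e \<in> S})
      - 2 * real (card {e \<in> arcs G. tail G e \<in> S \<and> head G e \<in> S})) / 2"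
    by (simp only: sum_distrib_left[symmetric] sum.distrib sum_subtractf c)
  \<comment> \<open>Reversing arcs matches heads in \<open>S\<close> with tails in \<open>S\<close>;
    the resulting factor 2 cancels the division by 2.\<close>
  also have "card {e \<in> arcs G. head G e \<in> S} = card {e \<in> arcs G. tail G e \<in> S}"
    using card_arcs_flip[of "\<lambda>u v. u \<in> S"] .
  finally show ?thesis
    by (simp add: card_arcs_tail_in[OF assms(1)] algebra_simps)
qed

text \<open>Only pairs separated by the cut contribute, so the double sum factors into the degree
  sum of \<open>S\<close> times that of its complement.\<close>

lemma (in fin_digraph) pair_energy_cut:
  assumes "S \<subseteq> verts G" and d: "d a a = 0" "d b b = 0" "d b a = d a b"
  shows "pair_energy G d (\<lambda>v. if v \<in> S then a else b) =
    (d a b)\<^sup>2 * (real (\<Sum>v\<in>S. out_degree G v)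
      * (real (vol G) - real (\<Sum>v\<in>S. out_degree G v)))"
proof -
  let ?w = "\<lambda>v. real (out_degree G v)" and ?i = "\<lambda>v. of_bool (v \<in> S) :: real"
  \<comment> \<open>The two degree sums are written with indicators over all of
    \<open>verts G\<close>, so that their products expand into the double sum of
    \<open>pair_energy\<close>.\<close>
  define A B where "A = (\<Sum>v\<in>verts G. ?i v * ?w v)" and "B = (\<Sum>v\<in>verts G. (1 - ?i v) * ?w v)"
  have A: "A = real (\<Sum>v\<in>S. out_degree G v)"
    unfolding A_def of_nat_sum using assms(1) by (intro sum.mono_neutral_cong_right) auto
  have B: "B = real (vol G) - A"
    unfolding A_def B_def vol_def by (simp add: left_diff_distrib sum_subtractf)
  have "pair_energy G d (\<lambda>v. if v \<in> S then a else b) =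
      (\<Sum>u\<in>verts G. \<Sum>v\<in>verts G. (d a b)\<^sup>2 * ((?i u * ?w u) * ((1 - ?i v) * ?w v)
        + ((1 - ?i u) * ?w u) * (?i v * ?w v))) / 2"
    unfolding pair_energy_def by (intro arg_cong2[of _ _ _ _ "(/)"] sum.cong) (auto simp: d)
  also have "\<dots> = (d a b)\<^sup>2 * (A * B + B * A) / 2"
    unfolding A_def B_def sum_product by (simp only: sum_distrib_left[symmetric] sum.distrib)
  finally show ?thesis
    by (simp add: A B)
qed

text \<open>The squared distance cancels, so the quotient of a cut depends on \<open>G\<close> and
  \<open>S\<close> alone and not on the target.\<close>

lemma (in graph) rayleigh_cut:
  assumes "S \<subseteq> verts G" and "d a a = 0" "d b b = 0" "d b a = d a b" "d a b \<noteq> 0"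
  shows "rayleigh G d (\<lambda>v. if v \<in> S then a else b) =
    real (vol G) * (real (\<Sum>v\<in>S. out_degree G v)
        - real (card {e \<in> arcs G. tail G e \<in> S \<and> head G e \<in> S}))
      / (real (\<Sum>v\<in>S. out_degree G v) * (real (vol G) - real (\<Sum>v\<in>S. out_degree G v)))"
proof -
  have "V * (c * x) / (c * y) = V * x / y" if "c \<noteq> 0" for V c x y :: real
    using that by simp
  then show ?thesis
    unfolding rayleigh_def edge_energy_cut[OF assms(1-4)] pair_energy_cut[OF assms(1-4)]
    using assms(5) by (simp only: power_eq_0_iff simp_thms)
qed

section \<open>The infimum\<close>

lemma pair_energy_nonneg: "pair_energy G d f \<ge> 0"
  unfolding pair_energy_def by (simp add: sum_nonneg)

lemma edge_energy_nonneg: "edge_energy G d f \<ge> 0"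
  unfolding edge_energy_def by (simp add: sum_nonneg)

lemma rayleigh_nonneg: "rayleigh G d f \<ge> 0"
  unfolding rayleigh_def by (simp add: pair_energy_nonneg edge_energy_nonneg)

lemma rayleigh_cong:
  assumes "wf_digraph G" "\<And>v. v \<in> verts G \<Longrightarrow> f v = g v"
  shows "rayleigh G d f = rayleigh G d g"
proof -
  interpret wf_digraph G by fact
  show ?thesis
    unfolding rayleigh_def edge_energy_def pair_energy_def
    by (simp add: assms(2) cong: sum.cong)
qed

lemma lambda_metric_le_rayleigh:
  assumes "f \<in> verts G \<rightarrow> M" "pair_energy G d f \<noteq> 0"
  shows "lambda_metric G M d \<le> rayleigh G d f"
  unfolding lambda_metric_def
proof (rule cInf_lower)
  show "bdd_below {rayleigh G d f | f. f \<in> verts G \<rightarrow> M \<and> pair_energy G d f \<noteq> 0}"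
    by (rule bdd_belowI[of _ 0]) (use rayleigh_nonneg in blast)
qed (use assms in blast)

text \<open>Up to values off the vertices there are only finitely many maps into a finite
  \<open>M\<close>, so the infimum is a minimum. The map \<open>f\<close> witnesses that the set of
  quotients is nonempty.\<close>

lemma lambda_metric_attained:
  assumes "fin_digraph G" "finite M" "f \<in> verts G \<rightarrow> M" "pair_energy G d f \<noteq> 0"
  obtains g where "g \<in> verts G \<rightarrow> M" "pair_energy G d g \<noteq> 0"
    "lambda_metric G M d = rayleigh G d g"
proof -
  interpret fin_digraph G by fact
  let ?X = "{rayleigh G d f | f. f \<in> verts G \<rightarrow> M \<and> pair_energy G d f \<noteq> 0}"
  have "?X \<subseteq> rayleigh G d ` (verts G \<rightarrow>\<^sub>E M)"
  proof
    fix x assume "x \<in> ?X"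
    then obtain g where g: "x = rayleigh G d g" "g \<in> verts G \<rightarrow> M" by blast
    \<comment> \<open>Membership in \<open>verts G \<rightarrow> M\<close> leaves values elsewhere
      free; restricting \<open>g\<close> keeps the quotient and lands in a finite function
      space.\<close>
    have "rayleigh G d (restrict g (verts G)) = x"
      using g(1) rayleigh_cong[OF wf_digraph_axioms, of "restrict g (verts G)" g] by simp
    then show "x \<in> rayleigh G d ` (verts G \<rightarrow>\<^sub>E M)"
      using g(2) by (metis image_eqI restrict_PiE_iff Pi_mem)
  qed
  then have fin: "finite ?X"
    by (rule finite_subset) (use assms(2) in \<open>simp add: finite_PiE\<close>)
  have "?X \<noteq> {}" using assms(3,4) by blast
  then have "Inf ?X \<in> ?X"
    using Min_in[OF fin] cInf_eq_Min[OF fin] by simp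
  then show ?thesis
    using that unfolding lambda_metric_def by blast
qed

text \<open>Zero energy makes \<open>f\<close> agree at the ends of every arc, hence along every
  walk. It serves in contrapositive form: an admissible map of energy 0 refutes
  connectivity.\<close>

lemma (in fin_digraph) pair_energy_eq_0_if_edge_energy_eq_0:
  assumes "Metric_space M d" "f \<in> verts G \<rightarrow> M" "edge_energy G d f = 0"
    and reach: "\<And>u v. u \<in> verts G \<Longrightarrow> v \<in> verts G \<Longrightarrow> u \<rightarrow>\<^sup>* v"
  shows "pair_energy G d f = 0"
proof -
  interpret Metric_space M d by fact
  have arc: "f (tail G e) = f (head G e)" if "e \<in> arcs G" for e
  proof -
    have "d (f (tail G e)) (f (head G e)) = 0"
      using assms(3) that by (simp add: edge_energy_def sum_nonneg_eq_0_iff)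
    moreover have "f (tail G e) \<in> M" "f (head G e) \<in> M"
      using that assms(2) by auto
    ultimately show ?thesis by simp
  qed
  have "f u = f v" if "u \<rightarrow>\<^sup>* v" for u v
    using that
  proof (induction rule: reachable_induct)
    case (step v w)
    then show ?case using arc by auto
  qed simp
  then have "d (f u) (f v) = 0" if "u \<in> verts G" "v \<in> verts G" for u v
    using reach[OF that] that assms(2) by (metis Pi_mem zero)
  then show ?thesis by (simp add: pair_energy_def)
qed

section \<open>Finite metric spaces as targets\<close>

text \<open>\<open>connected\<close> refers to the symmetric closure, which adds no adjacency here
  because arcs come in opposite pairs.\<close>

lemma (in graph) connected_iff_reachable:
  "Digraph_Component.connected G \<longleftrightarrow> verts G \<noteq> {} \<and> (\<forall>u\<in>verts G. \<forall>v\<in>verts G. u \<rightarrow>\<^sup>* v)"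
  by (simp add: connected_def strongly_connected_def reachable_mk_symmetric_eq[OF sym_arcs])

lemma (in nomulti_digraph) out_degree_eq_card_neighbours: "out_degree G u = card {v. u \<rightarrow>\<^bsub>G\<^esub> v}"
proof -
  have "{v. u \<rightarrow>\<^bsub>G\<^esub> v} = head G ` out_arcs G u"
    by (auto simp: arcs_ends_def arc_to_ends_def)
  moreover have "inj_on (head G) (out_arcs G u)"
    by (auto simp: inj_on_def arc_to_ends_def intro: no_multi_arcs)
  ultimately show ?thesis by (simp add: out_degree_def card_image)
qed

lemma (in loopfree_digraph) neighbours_subset: "{v. u \<rightarrow>\<^bsub>G\<^esub> v} \<subseteq> verts G - {u}"
  by (auto dest: adj_not_same adj_in_verts)

text \<open>The neighbours of a vertex lie among the other n - 1 vertices, so having n - 1 of them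
  means having all of them.\<close>

lemma (in graph) complete_digraph_iff_out_degree:
  "complete_digraph (card (verts G)) G \<longleftrightarrow> (\<forall>u\<in>verts G. out_degree G u = card (verts G) - 1)"
proof -
  have "out_degree G u = card (verts G) - 1 \<longleftrightarrow> {v. u \<rightarrow>\<^bsub>G\<^esub> v} = verts G - {u}"
    if "u \<in> verts G" for u
  proof -
    have c: "card (verts G - {u}) = card (verts G) - 1" using that by simp
    have "finite (verts G - {u})" by simp
    from card_subset_eq[OF this neighbours_subset] c show ?thesis
      unfolding out_degree_eq_card_neighbours by metis
  qed
  moreover have "complete_digraph (card (verts G)) G \<longleftrightarrow>
      (\<forall>u\<in>verts G. {v. u \<rightarrow>\<^bsub>G\<^esub> v} = verts G - {u})"
  proof
    assume "complete_digraph (card (verts G)) G"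
    then show "\<forall>u\<in>verts G. {v. u \<rightarrow>\<^bsub>G\<^esub> v} = verts G - {u}"
      unfolding complete_digraph_def by auto
  next
    assume *: "\<forall>u\<in>verts G. {v. u \<rightarrow>\<^bsub>G\<^esub> v} = verts G - {u}"
    have "(u, v) \<in> arcs_ends G \<longleftrightarrow> u \<in> verts G \<and> v \<in> verts G \<and> u \<noteq> v" for u v
      using *[rule_format, of u] adj_in_verts(1)[of u v] by blast
    then show "complete_digraph (card (verts G)) G"
      unfolding complete_digraph_def using graph_axioms by auto
  qed
  ultimately show ?thesis by auto
qed

text \<open>Positive degrees make every nontrivial cut admissible. An isolated vertex carries weight
  0: an edge plus an isolated vertex is disconnected, yet every admissible quotient is 2, which also
  exceeds 3/2.\<close>

locale graph_without_isolated = graph G for G :: "('a, 'b) pre_digraph" +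
  assumes out_degree_pos: "v \<in> verts G \<Longrightarrow> out_degree G v > 0"
    and card_verts_ge_2: "card (verts G) \<ge> 2"
begin

section \<open>Upper bounds from cuts, and the cases of equality\<close>

lemma sum_out_degree_lt_vol:
  assumes "S \<subset> verts G"
  shows "(\<Sum>v\<in>S. out_degree G v) < vol G"
proof -
  obtain u where "u \<in> verts G - S" using assms by blast
  then show ?thesis
    unfolding vol_def using assms out_degree_pos by (intro sum_strict_mono2[of _ _ u]) auto
qed

lemma sum_out_degree_pos:
  assumes "S \<subseteq> verts G" "S \<noteq> {}"
  shows "(\<Sum>v\<in>S. out_degree G v) > 0"
proof (rule sum_pos)
  show "finite S" using assms(1) finite_verts by (rule finite_subset)
  show "0 < out_degree G v" if "v \<in> S" for v
    using assms(1) that by (intro out_degree_pos) (rule subsetD)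
qed fact

text \<open>For nonempty proper \<open>S\<close> both sides of the cut have positive degree sum and
  \<open>a\<close>, \<open>b\<close> are at nonzero distance, so the cut map competes in the
  infimum.\<close>

lemma lambda_metric_le_cut:
  assumes "Metric_space M d" "a \<in> M" "b \<in> M" "a \<noteq> b" and S: "S \<subset> verts G" "S \<noteq> {}"
  shows "lambda_metric G M d \<le>
    real (vol G) * (real (\<Sum>v\<in>S. out_degree G v)
        - real (card {e \<in> arcs G. tail G e \<in> S \<and> head G e \<in> S}))
      / (real (\<Sum>v\<in>S. out_degree G v) * (real (vol G) - real (\<Sum>v\<in>S. out_degree G v)))"
    and "pair_energy G d (\<lambda>v. if v \<in> S then a else b) \<noteq> 0"
proof -
  interpret Metric_space M d by fact
  have d: "d a a = 0" "d b b = 0" "d b a = d a b" "d a b \<noteq> 0"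
    using assms by (auto simp: commute)
  have "S \<subseteq> verts G" using S by auto
  show ne: "pair_energy G d (\<lambda>v. if v \<in> S then a else b) \<noteq> 0"
    unfolding pair_energy_cut[OF \<open>S \<subseteq> verts G\<close> d(1-3)]
    using d(4) sum_out_degree_lt_vol[OF S(1)] sum_out_degree_pos[OF \<open>S \<subseteq> verts G\<close> S(2)]
    by (simp del: of_nat_sum)
  show "lambda_metric G M d \<le>
    real (vol G) * (real (\<Sum>v\<in>S. out_degree G v)
        - real (card {e \<in> arcs G. tail G e \<in> S \<and> head G e \<in> S}))
      / (real (\<Sum>v\<in>S. out_degree G v) * (real (vol G) - real (\<Sum>v\<in>S. out_degree G v)))"
    unfolding rayleigh_cut[OF \<open>S \<subseteq> verts G\<close> d, symmetric]
    by (rule lambda_metric_le_rayleigh) (use assms ne in auto)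
qed

lemma lambda_metric_le_vertex_cut:
  assumes "Metric_space M d" "a \<in> M" "b \<in> M" "a \<noteq> b" and v: "v \<in> verts G"
  shows "lambda_metric G M d \<le> real (vol G) / (real (vol G) - real (out_degree G v))"
    and "pair_energy G d (\<lambda>x. if x \<in> {v} then a else b) \<noteq> 0"
    and "out_degree G v < vol G"
proof -
  have "{v} \<noteq> verts G" using card_verts_ge_2 by (auto dest: arg_cong[of _ _ card])
  with v have S: "{v} \<subset> verts G" "{v} \<noteq> {}" by auto
  \<comment> \<open>An arc inside a singleton would be a loop. With no inner arcs the degree of
    \<open>v\<close> cancels from the cut quotient.\<close>
  have "{e \<in> arcs G. tail G e \<in> {v} \<and> head G e \<in> {v}} = {}"
    using no_loops by force
  then have inner: "card {e \<in> arcs G. tail G e \<in> {v} \<and> head G e \<in> {v}} = 0"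
    by (simp only: card.empty)
  show "lambda_metric G M d \<le> real (vol G) / (real (vol G) - real (out_degree G v))"
    using lambda_metric_le_cut(1)[OF assms(1-4) S] out_degree_pos[OF v] unfolding inner by simp
  show "pair_energy G d (\<lambda>x. if x \<in> {v} then a else b) \<noteq> 0"
    using lambda_metric_le_cut(2)[OF assms(1-4) S] .
  show "out_degree G v < vol G"
    using sum_out_degree_lt_vol[OF S(1)] by simp
qed

text \<open>If the value is 0, a minimiser has energy 0 itself, which connectivity forbids; this is
  where attainment matters. Conversely, a component is a cut without boundary.\<close>

lemma lambda_metric_eq_0_iff:
  assumes "Metric_space M d" "finite M" "a \<in> M" "b \<in> M" "a \<noteq> b"
  shows "lambda_metric G M d = 0 \<longleftrightarrow> \<not> Digraph_Component.connected G"
proof -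
  have ne: "verts G \<noteq> {}" using card_verts_ge_2 by auto
  then obtain v where "v \<in> verts G" by blast
  have "(\<lambda>x. if x \<in> {v} then a else b) \<in> verts G \<rightarrow> M" using assms by auto
  then obtain g where g: "g \<in> verts G \<rightarrow> M" "pair_energy G d g \<noteq> 0"
    "lambda_metric G M d = rayleigh G d g"
    using lambda_metric_attained[OF fin_digraph_axioms assms(2)]
      lambda_metric_le_vertex_cut(2)[OF assms(1,3-5) \<open>v \<in> verts G\<close>] by blast
  show ?thesis
  proof
    assume "lambda_metric G M d = 0"
    moreover have "vol G > 0"
      using sum_out_degree_pos[of "verts G"] ne by (simp add: vol_def)
    ultimately have "edge_energy G d g = 0"
      using g by (auto simp: rayleigh_def)
    then show "\<not> Digraph_Component.connected G"
      using pair_energy_eq_0_if_edge_energy_eq_0[OF assms(1) g(1)] g(2)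
      by (auto simp: connected_iff_reachable)
  next
    assume "\<not> Digraph_Component.connected G"
    then obtain u w where uw: "u \<in> verts G" "w \<in> verts G" "\<not> u \<rightarrow>\<^sup>*\<^bsub>G\<^esub> w"
      using ne by (auto simp: connected_iff_reachable)
    \<comment> \<open>The component of \<open>u\<close>: it misses \<open>w\<close>, and no arc
      leaves it, so every arc with tail in \<open>S\<close> is an inner arc and the cut quotient has
      numerator 0.\<close>
    define S where "S = {x. u \<rightarrow>\<^sup>*\<^bsub>G\<^esub> x}"
    have S: "S \<subset> verts G" "S \<noteq> {}"
      using uw reachable_in_verts by (auto simp: S_def)
    have "head G e \<in> S" if "e \<in> arcs G" "tail G e \<in> S" for e
      using that unfolding S_def by (auto intro: reachable_adj_trans in_arcs_imp_in_arcs_ends)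
    then have "{e \<in> arcs G. tail G e \<in> S \<and> head G e \<in> S} = {e \<in> arcs G. tail G e \<in> S}"
      by auto
    then have "lambda_metric G M d \<le> 0"
      using lambda_metric_le_cut(1)[OF assms(1,3-5) S] S by (simp add: card_arcs_tail_in)
    moreover have "lambda_metric G M d \<ge> 0"
      using g(3) rayleigh_nonneg by metis
    ultimately show "lambda_metric G M d = 0" by simp
  qed
qed

text \<open>For a vertex of minimal degree d, the inequality vol/(vol - d) \<le> n/(n - 1) amounts
  to n d \<le> vol: the minimum degree is at most the average. Equality means that minimum and
  average coincide.\<close>

lemma lambda_metric_le:
  assumes "Metric_space M d" "a \<in> M" "b \<in> M" "a \<noteq> b"
  shows "lambda_metric G M d \<le> real (card (verts G)) / (real (card (verts G)) - 1)"
    and "lambda_metric G M d = real (card (verts G)) / (real (card (verts G)) - 1) \<Longrightarrow>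
      \<exists>k. \<forall>v\<in>verts G. out_degree G v = k"
proof -
  let ?n = "real (card (verts G))"
  have n: "?n \<ge> 2" using card_verts_ge_2 by simp
  have ne: "verts G \<noteq> {}" using card_verts_ge_2 by auto
  define v where "v = arg_min_on (out_degree G) (verts G)"
  have v: "v \<in> verts G" "\<And>u. u \<in> verts G \<Longrightarrow> out_degree G v \<le> out_degree G u"
    using arg_min_if_finite(1)[OF finite_verts ne] arg_min_least[OF finite_verts ne]
    unfolding v_def by blast+
  have V: "card (verts G) * out_degree G v \<le> vol G"
    unfolding vol_def using sum_bounded_below[of "verts G" "out_degree G v"] v by simp
  then have V': "?n * real (out_degree G v) \<le> real (vol G)"
    by (metis of_nat_le_iff of_nat_mult)
  note cut = lambda_metric_le_vertex_cut(1,3)[OF assms v(1)]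
  have "real (vol G) / (real (vol G) - real (out_degree G v)) \<le> ?n / (?n - 1)"
    using cut(2) n V' by (simp add: divide_simps) (simp add: algebra_simps)
  then show "lambda_metric G M d \<le> ?n / (?n - 1)"
    using cut(1) by linarith
  assume "lambda_metric G M d = ?n / (?n - 1)"
  then have "?n / (?n - 1) \<le> real (vol G) / (real (vol G) - real (out_degree G v))"
    using cut(1) by simp
  then have "real (vol G) \<le> ?n * real (out_degree G v)"
    using cut(2) n by (simp add: divide_simps) (simp add: algebra_simps)
  then have "vol G \<le> card (verts G) * out_degree G v"
    by (metis of_nat_le_iff of_nat_mult)
  \<comment> \<open>The total excess of the degrees over the minimum vanishes, hence so does each
    excess; minimality makes the natural-number subtraction exact.\<close>
  with V have "(\<Sum>u\<in>verts G. out_degree G u - out_degree G v) = 0"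
    using v by (subst sum_subtractf_nat) (auto simp: vol_def)
  then have "\<forall>u\<in>verts G. out_degree G u = out_degree G v"
    using v by (auto intro: antisym)
  then show "\<exists>k. \<forall>v\<in>verts G. out_degree G v = k" by blast
qed

text \<open>For regular graphs a single-vertex cut gives exactly n/(n - 1), so a larger cut is
  needed. The two ends of an edge have degree sum 2k, of which the edge between them absorbs
  2.\<close>

lemma lambda_metric_lt_if_regular_not_complete:
  assumes "Metric_space M d" "a \<in> M" "b \<in> M" "a \<noteq> b"
    and reg: "\<And>v. v \<in> verts G \<Longrightarrow> out_degree G v = k"
    and nc: "\<not> complete_digraph (card (verts G)) G"
  shows "lambda_metric G M d < real (card (verts G)) / (real (card (verts G)) - 1)"
proof -
  let ?n = "real (card (verts G))"
  have "verts G \<noteq> {}" using card_verts_ge_2 by auto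
  then obtain u where u: "u \<in> verts G" by blast
  have k: "k > 0" using out_degree_pos[OF u] reg[OF u] by simp
  have "k \<le> card (verts G - {u})"
    using card_mono[OF _ neighbours_subset[of u]] reg[OF u] by (simp add: out_degree_eq_card_neighbours)
  moreover have "k \<noteq> card (verts G) - 1"
    using nc reg by (auto simp: complete_digraph_iff_out_degree)
  \<comment> \<open>This is what incompleteness contributes. With k > 0 it gives n > 2, so two
    vertices form a proper subset, and it yields the strict inequality at the end.\<close>
  ultimately have kn: "k + 1 < card (verts G)" using u card_verts_ge_2 by simp
  have "{v. u \<rightarrow>\<^bsub>G\<^esub> v} \<noteq> {}"
    using k reg[OF u] by (metis out_degree_eq_card_neighbours card.empty less_irrefl)
  then obtain w where w: "u \<rightarrow>\<^bsub>G\<^esub> w" by blast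
  then have "w \<in> verts G" "u \<noteq> w" using neighbours_subset[of u] by auto
  have wu: "w \<rightarrow>\<^bsub>G\<^esub> u" using w by (rule graph_symmetric)
  have S: "{u, w} \<subset> verts G" "{u, w} \<noteq> {}"
  proof -
    have "{u, w} \<noteq> verts G"
    proof
      assume "{u, w} = verts G"
      then have "card (verts G) = 2" using \<open>u \<noteq> w\<close> by (metis card_2_iff)
      then show False using kn k by simp
    qed
    then show "{u, w} \<subset> verts G" using u \<open>w \<in> verts G\<close> by auto
  qed simp
  have "card {e \<in> arcs G. tail G e \<in> {u, w} \<and> head G e \<in> {u, w}} =
      card {(x, y). x \<rightarrow>\<^bsub>G\<^esub> y \<and> x \<in> {u, w} \<and> y \<in> {u, w}}"
    by (rule card_arcs_arcs_ends)
  also have "{(x, y). x \<rightarrow>\<^bsub>G\<^esub> y \<and> x \<in> {u, w} \<and> y \<in> {u, w}} = {(u, w), (w, u)}"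
    using w wu neighbours_subset[of u] neighbours_subset[of w] by auto
  finally have inner: "card {e \<in> arcs G. tail G e \<in> {u, w} \<and> head G e \<in> {u, w}} = 2"
    using \<open>u \<noteq> w\<close> by simp
  have vS: "(\<Sum>v\<in>{u, w}. out_degree G v) = 2 * k"
    using \<open>u \<noteq> w\<close> reg u \<open>w \<in> verts G\<close> by simp
  have vol: "vol G = card (verts G) * k"
    by (simp add: vol_def reg)
  define n K where "n = ?n" and "K = real k"
  have nK: "n > K + 1" "K \<ge> 1" using kn k by (auto simp: n_def K_def)
  have "lambda_metric G M d \<le> n * K * (2 * K - 2) / (2 * K * (n * K - 2 * K))"
    using lambda_metric_le_cut(1)[OF assms(1-4) S] unfolding inner vS vol
    by (simp add: n_def K_def)
  also have "\<dots> = n * (K - 1) / (K * (n - 2))"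
    using nK by (simp add: divide_simps) (simp add: algebra_simps)
  also have "\<dots> < n / (n - 1)"
  proof -
    \<comment> \<open>After expansion this is exactly K + 1 < n.\<close>
    have "(K - 1) * (n - 1) < K * (n - 2)" using nK by (simp add: algebra_simps)
    then have "n * ((K - 1) * (n - 1)) < n * (K * (n - 2))" using nK by simp
    then show ?thesis using nK by (simp add: divide_simps mult.assoc)
  qed
  finally show ?thesis by (simp add: n_def)
qed

text \<open>All weights equal (n - 1)^2 and every pair of distinct vertices is an edge, so numerator
  and denominator sums agree up to that factor; the volume n(n - 1) leaves n/(n - 1).\<close>

lemma rayleigh_complete:
  assumes "complete_digraph (card (verts G)) G" "Metric_space M d" "f \<in> verts G \<rightarrow> M"
    and "pair_energy G d f \<noteq> 0"
  shows "rayleigh G d f = real (card (verts G)) / (real (card (verts G)) - 1)"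
proof -
  interpret Metric_space M d by fact
  define n where "n = real (card (verts G))"
  have n: "n \<ge> 2" using card_verts_ge_2 by (simp add: n_def)
  have deg: "real (out_degree G v) = n - 1" if "v \<in> verts G" for v
    using assms(1) that card_verts_ge_2
    by (simp add: complete_digraph_iff_out_degree n_def of_nat_diff)
  have vol: "real (vol G) = n * (n - 1)"
    by (simp add: vol_def deg n_def)
  have d0: "d (f v) (f v) = 0" if "v \<in> verts G" for v
    using assms(3) that zero[of "f v" "f v"] by (auto simp: Pi_iff)
  let ?D = "\<lambda>p. (d (f (fst p)) (f (snd p)))\<^sup>2"
  have inj: "inj_on (arc_to_ends G) (arcs G)"
    by (auto simp: inj_on_def intro: no_multi_arcs)
  have "edge_energy G d f = (\<Sum>p\<in>arcs_ends G. ?D p) / 2"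
    unfolding edge_energy_def arcs_ends_def sum.reindex[OF inj] by (simp add: arc_to_ends_def)
  \<comment> \<open>Only diagonal pairs are added, and they contribute 0.\<close>
  also have "(\<Sum>p\<in>arcs_ends G. ?D p) = (\<Sum>p\<in>verts G \<times> verts G. ?D p)"
    using assms(1) by (intro sum.mono_neutral_left) (auto simp: complete_digraph_def d0)
  finally have E: "2 * edge_energy G d f = (\<Sum>u\<in>verts G. \<Sum>v\<in>verts G. (d (f u) (f v))\<^sup>2)"
    by (simp add: sum.cartesian_product split_beta)
  have "pair_energy G d f =
      (\<Sum>u\<in>verts G. \<Sum>v\<in>verts G. (n - 1)\<^sup>2 * (d (f u) (f v))\<^sup>2) / 2"
    unfolding pair_energy_def
    by (intro arg_cong2[of _ _ _ _ "(/)"] sum.cong) (auto simp: deg power2_eq_square)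
  also have "\<dots> = (n - 1)\<^sup>2 * edge_energy G d f"
    by (simp add: E[symmetric] sum_distrib_left[symmetric])
  finally have P: "pair_energy G d f = (n - 1)\<^sup>2 * edge_energy G d f" .
  with assms(4) have "edge_energy G d f \<noteq> 0" by auto
  then show ?thesis
    using n unfolding rayleigh_def vol P n_def[symmetric]
    by (simp add: power2_eq_square)
qed

text \<open>Equality forces regularity, and a regular incomplete graph lies strictly below the
  bound. On a complete graph the minimiser, like any admissible map, has the extremal
  quotient.\<close>

lemma lambda_metric_eq_iff_complete:
  assumes "Metric_space M d" "finite M" "a \<in> M" "b \<in> M" "a \<noteq> b"
  shows "lambda_metric G M d = real (card (verts G)) / (real (card (verts G)) - 1)
    \<longleftrightarrow> complete_digraph (card (verts G)) G"
proof
  assume eq: "lambda_metric G M d = real (card (verts G)) / (real (card (verts G)) - 1)"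
  then obtain k where "\<forall>v\<in>verts G. out_degree G v = k"
    using lambda_metric_le(2)[OF assms(1,3-5)] by blast
  then show "complete_digraph (card (verts G)) G"
    using lambda_metric_lt_if_regular_not_complete[OF assms(1,3-5), of k] eq by auto
next
  assume c: "complete_digraph (card (verts G)) G"
  have "verts G \<noteq> {}" using card_verts_ge_2 by auto
  then obtain v where v: "v \<in> verts G" by blast
  have "(\<lambda>x. if x \<in> {v} then a else b) \<in> verts G \<rightarrow> M" using assms by auto
  then obtain g where "g \<in> verts G \<rightarrow> M" "pair_energy G d g \<noteq> 0"
    "lambda_metric G M d = rayleigh G d g"
    using lambda_metric_attained[OF fin_digraph_axioms assms(2)]
      lambda_metric_le_vertex_cut(2)[OF assms(1,3-5) v] by blast
  then show "lambda_metric G M d = real (card (verts G)) / (real (card (verts G)) - 1)"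
    using rayleigh_complete[OF c assms(1)] by simp
qed

end

section \<open>The theorem for graphs as targets\<close>

theorem theorem1p1:
  fixes G :: "('a, 'b) pre_digraph" and H :: "('c, 'e) pre_digraph" and n :: nat
  assumes "graph G" and "card (verts G) = n" and "n \<ge> 2"
    and no_isolated: "\<forall>v\<in>verts G. out_degree G v > 0"
    and "graph H" and "Digraph_Component.connected H" and "card (verts H) \<ge> 2"
  shows "(lambda_graph G H = 0 \<longleftrightarrow> \<not> Digraph_Component.connected G) \<and>
    lambda_graph G H \<le> real n / (real n - 1) \<and>
    (lambda_graph G H = real n / (real n - 1) \<longleftrightarrow> complete_digraph n G)"
proof -
  interpret H: graph H by fact
  interpret G: graph_without_isolated G
    using assms(1-4) by (simp add: graph_without_isolated_def graph_without_isolated_axioms_def)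
  \<comment> \<open>The target enters only as a finite metric space with two distinct
    points.\<close>
  have M: "Metric_space (verts H) (graph_dist H)"
    using Metric_space_graph_dist assms(5,6) .
  obtain a b where ab: "a \<in> verts H" "b \<in> verts H" "a \<noteq> b"
    using assms(7) card_le_Suc0_iff_eq[OF H.finite_verts] by fastforce
  show ?thesis
    unfolding lambda_graph_def assms(2)[symmetric]
    using G.lambda_metric_eq_0_iff[OF M H.finite_verts ab] G.lambda_metric_le(1)[OF M ab]
      G.lambda_metric_eq_iff_complete[OF M H.finite_verts ab] by blast
qed

end
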